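(* Let $r \ge 2$ be an integer and let $f_1,\ldots,f_r : \mathbb{Z}\to\mathbb{C}^*$ be group homomorphisms such that the partial products $g_i := \prod_{1\le j\le i} f_j$ satisfy $|g_i(1)|\le 1$ for all $1\le i\le r$, and assume $f_1(1)=1$. Then for all $(s_1,\ldots,s_r)\in U_r$, $$L_{r-1}(f_2,\ldots,f_r;\ s_1+s_2-1,s_3,\ldots,s_r) = \sum_{k\ge 0} (s_1-1)_k\, L_r(f_1,\ldots,f_r;\ s_1+k,s_2,\ldots,s_r),$$ where the series on the right hand side converges normally on every compact subset of $U_r$.
   Context: $U_r := \{ (s_1,\ldots,s_r) \in \mathbb{C}^r : \Re(s_1+\cdots+s_i) > i \text{ for all } 1 \le i \le r\}$. For additive characters $f_1,\ldots,f_r$ (group homomorphisms $\mathbb{Z}\to\mathbb{C}^*$) with $|g_i(1)|\le 1$ for all partial products $g_i=f_1\cdots f_i$, the multiple additive $L$-function is $$L_r(f_1,\ldots,f_r;\ s_1,\ldots,s_r) := \sum_{n_1>\cdots>n_r>0} \frac{f_1(n_1)\cdots f_r(n_r)}{n_1^{s_1}\cdots n_r^{s_r}},$$ which converges absolutely on $U_r$. For $s\in\mathbb{C}$ and integer $k\ge0$, $(s)_k := \frac{s(s+1)\cdots(s+k)}{(k+1)!}$. A series of functions converges normally on a set $X$ if the sum of the sup-norms over $X$ of its terms is finite. *)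

theory Defs
  imports "HOL-Analysis.Analysis"
begin

text \<open>
  A point \<open>(s\<^sub>1, \<dots>, s\<^sub>r)\<close> of \<open>\<complex>\<^sup>r\<close> is represented by an extensional function
  in \<open>{1..r} \<rightarrow>\<^sub>E UNIV\<close>, the carrier of \<^term>\<open>cspace r\<close>; indices start at 1.
\<close>

definition cspace :: "nat \<Rightarrow> (nat \<Rightarrow> complex) topology" where
  "cspace r = product_topology (\<lambda>_. euclidean) {1..r}"

definition U :: "nat \<Rightarrow> (nat \<Rightarrow> complex) set" where
  "U r = {s \<in> {1..r} \<rightarrow>\<^sub>E UNIV. \<forall>i\<in>{1..r}. Re (\<Sum>j=1..i. s j) > real i}"

text \<open>Group homomorphisms from the additive group of integers to \<open>\<complex>\<^sup>*\<close>.\<close>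

definition additive_character :: "(int \<Rightarrow> complex) \<Rightarrow> bool" where
  "additive_character f \<longleftrightarrow>
     (\<forall>n. f n \<noteq> 0) \<and> (\<forall>m n. f (m + n) = f m * f n)"

definition partial_product :: "(nat \<Rightarrow> int \<Rightarrow> complex) \<Rightarrow> nat \<Rightarrow> int \<Rightarrow> complex" where
  "partial_product f i n = (\<Prod>j=1..i. f j n)"

definition decreasing_tuples :: "nat \<Rightarrow> (nat \<Rightarrow> nat) set" where
  "decreasing_tuples r =
     {n \<in> {1..r} \<rightarrow>\<^sub>E {0<..}. \<forall>i\<in>{1..r}. \<forall>j\<in>{1..r}. i < j \<longrightarrow> n i > n j}"

text \<open>
  The sum is the unordered one, which for complex terms is absolute convergence. Only
  the entries of \<open>f\<close> and \<open>s\<close> with index in \<open>{1..r}\<close> matter.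
\<close>

definition multiple_L :: "nat \<Rightarrow> (nat \<Rightarrow> int \<Rightarrow> complex) \<Rightarrow> (nat \<Rightarrow> complex) \<Rightarrow> complex" where
  "multiple_L r f s =
     (\<Sum>\<^sub>\<infinity>n\<in>decreasing_tuples r.
        (\<Prod>i=1..r. f i (int (n i))) / (\<Prod>i=1..r. of_nat (n i) powr s i))"

text \<open>
  \<open>(s)\<^sub>k = s (s + 1) \<dots> (s + k) / (k + 1)!\<close> has \<open>k + 1\<close> factors, so it is a
  Pochhammer symbol of length \<open>k + 1\<close> rather than \<open>k\<close>.
\<close>

definition shifted_poch :: "complex \<Rightarrow> nat \<Rightarrow> complex" where
  "shifted_poch s k = pochhammer s (k + 1) / fact (k + 1)"

text \<open>
  The sup-norms are taken in \<^typ>\<open>ennreal\<close>, so unbounded terms have sup-norm \<open>\<infinity>\<close>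
  and the supremum over the empty set is 0.
\<close>

definition normally_convergent_on :: "'a set \<Rightarrow> (nat \<Rightarrow> 'a \<Rightarrow> complex) \<Rightarrow> bool" where
  "normally_convergent_on X F \<longleftrightarrow> (\<Sum>k. SUP x\<in>X. ennreal (norm (F k x))) < \<infinity>"

end

theory Submission
  imports Defs
begin

text \<open>
  For \<open>n > 1\<close> the binomial series gives
  \<open>\<Sum>k. (s - 1)\<^sub>k n powr (- s - k) = (n - 1) powr (1 - s) - n powr (1 - s)\<close>; as \<open>f\<^sub>1 = 1\<close>, summing
  this over \<open>n\<^sub>1 > n\<^sub>2\<close> telescopes to \<open>n\<^sub>2 powr (1 - s)\<close>. The interchange of sums and the normal
  convergence both follow from one majorant: on a compact \<open>K \<subseteq> U\<^sub>r\<close> there is \<open>d > 1\<close> such that the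
  real parts of the \<open>i\<close>-th partial sums are at least \<open>i d\<close>, so that summation by parts bounds the
  terms of \<open>L\<^sub>r\<close> by \<open>\<Prod>i. n\<^sub>i powr (- d)\<close>. The shift of \<open>s\<^sub>1\<close> by \<open>k\<close> gains a further factor
  \<open>n\<^sub>1 powr (- k) \<le> 2 powr (- k)\<close>, because \<open>n\<^sub>1 > n\<^sub>2 \<ge> 1\<close>, and this absorbs the polynomial growth
  of \<open>(s\<^sub>1 - 1)\<^sub>k\<close> in \<open>k\<close>.
\<close>

section \<open>Summation by parts and a majorant for the terms of the L-series\<close>

text \<open>Abel summation by induction: the partial sum up to \<open>r\<close> is nonnegative, so
  lowering its factor from \<open>x r\<close> to \<open>x (Suc r)\<close> can only decrease the
  product. It is applied with \<open>x j = n j\<close> for the characters and with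
  \<open>x j = ln (n j)\<close> for the powers.\<close>

lemma sum_mult_decreasing_ge:
  fixes a x :: "nat \<Rightarrow> real"
  assumes "\<And>i. 1 \<le> i \<Longrightarrow> i \<le> r \<Longrightarrow> 0 \<le> (\<Sum>j=1..i. a j)"
    and "\<And>i. 1 \<le> i \<Longrightarrow> i < r \<Longrightarrow> x (Suc i) \<le> x i"
  shows "(\<Sum>j=1..r. a j) * x r \<le> (\<Sum>j=1..r. a j * x j)"
  using assms
proof (induction r)
  case 0
  then show ?case by simp
next
  case (Suc r)
  show ?case
  proof (cases "r = 0")
    case False
    have IH: "(\<Sum>j=1..r. a j) * x r \<le> (\<Sum>j=1..r. a j * x j)"
      using Suc.prems by (intro Suc.IH) auto
    have "(\<Sum>j=1..r. a j) * x (Suc r) \<le> (\<Sum>j=1..r. a j) * x r"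
      using Suc.prems False by (intro mult_left_mono) auto
    with IH show ?thesis by (simp add: distrib_right)
  qed simp
qed

lemma additive_character_of_nat:
  assumes "additive_character f"
  shows "f (int n) = f 1 ^ n"
proof (induction n)
  case 0
  have "f 0 * f 0 = f 0 * 1"
    using assms unfolding additive_character_def by (metis add.right_neutral mult.right_neutral)
  then show ?case
    using assms unfolding additive_character_def by simp
next
  case (Suc n)
  have "f (int n + 1) = f (int n) * f 1"
    using assms unfolding additive_character_def by blast
  then show ?case
    using Suc by (simp add: add.commute mult.commute)
qed

lemma decreasing_tuples_pos:
  assumes "n \<in> decreasing_tuples r" "i \<in> {1..r}"
  shows "0 < n i"
  using assms by (force simp: decreasing_tuples_def)

text \<open>A single \<open>f i 1\<close> may have norm above 1, so the factors cannot be bounded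
  one by one. With \<open>a i = - ln (norm (f i 1))\<close> the norm is \<open>exp\<close> of minus
  the sum of the \<open>a i * n i\<close>, and the hypothesis on the partial products says that all
  partial sums of \<open>a\<close> are nonnegative.\<close>

lemma norm_prod_characters_le_1:
  fixes f :: "nat \<Rightarrow> int \<Rightarrow> complex"
  assumes char: "\<And>i. i \<in> {1..r} \<Longrightarrow> additive_character (f i)"
    and g: "\<And>i. i \<in> {1..r} \<Longrightarrow> norm (partial_product f i 1) \<le> 1"
    and n: "n \<in> decreasing_tuples r"
  shows "norm (\<Prod>i=1..r. f i (int (n i))) \<le> 1"
proof (cases "r = 0")
  case False
  define a where "a i = - ln (norm (f i 1))" for i
  have nz: "norm (f i 1) > 0" if "i \<in> {1..r}" for i
    using char[OF that] by (simp add: additive_character_def)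
  have A: "0 \<le> (\<Sum>j=1..i. a j)" if "1 \<le> i" "i \<le> r" for i
  proof -
    have pos: "0 < norm (f j 1)" if "j \<in> {1..i}" for j
      using nz that \<open>i \<le> r\<close> by simp
    have "(\<Prod>j=1..i. norm (f j 1)) \<le> 1"
      using g[of i] that by (simp add: partial_product_def prod_norm)
    moreover have "0 < (\<Prod>j=1..i. norm (f j 1))"
      using pos by (rule prod_pos)
    ultimately have "ln (\<Prod>j=1..i. norm (f j 1)) \<le> 0"
      by simp
    moreover have "ln (\<Prod>j=1..i. norm (f j 1)) = (\<Sum>j=1..i. ln (norm (f j 1)))"
      using pos by (intro ln_prod) auto
    ultimately show ?thesis
      by (simp add: a_def sum_negf)
  qed
  have "(\<Sum>j=1..r. a j) * real (n r) \<le> (\<Sum>j=1..r. a j * real (n j))"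
    using n by (intro sum_mult_decreasing_ge A) (auto simp: decreasing_tuples_def less_imp_le)
  moreover have "0 \<le> (\<Sum>j=1..r. a j) * real (n r)"
    using A False by simp
  ultimately have ge: "0 \<le> (\<Sum>j=1..r. a j * real (n j))" by linarith
  have "norm (\<Prod>i=1..r. f i (int (n i))) = (\<Prod>i=1..r. norm (f i 1) ^ n i)"
    unfolding prod_norm[symmetric]
    by (rule prod.cong) (simp_all add: additive_character_of_nat[OF char] norm_power)
  also have "\<dots> = (\<Prod>i=1..r. exp (- (a i * real (n i))))"
  proof (rule prod.cong[OF refl])
    fix i assume "i \<in> {1..r}"
    then have "norm (f i 1) ^ n i = exp (ln (norm (f i 1))) ^ n i"
      using nz by simp
    then show "norm (f i 1) ^ n i = exp (- (a i * real (n i)))"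
      by (simp add: a_def exp_of_nat_mult[symmetric] mult.commute)
  qed
  also have "\<dots> = exp (- (\<Sum>i=1..r. a i * real (n i)))"
    by (simp add: exp_sum sum_negf[symmetric])
  finally show ?thesis using ge by simp
qed simp

text \<open>Again a single \<open>\<sigma> i\<close> may lie below \<open>d\<close>. Abel summation
  is applied to the coefficients \<open>\<sigma> j - d\<close> and the decreasing values
  \<open>ln (n j)\<close>, the last of which is nonnegative because
  \<open>n r \<ge> 1\<close>.\<close>

lemma prod_powr_decreasing_le:
  fixes \<sigma> :: "nat \<Rightarrow> real"
  assumes \<sigma>: "\<And>i. i \<in> {1..r} \<Longrightarrow> real i * d \<le> (\<Sum>j=1..i. \<sigma> j)"
    and n: "n \<in> decreasing_tuples r"
  shows "(\<Prod>i=1..r. real (n i) powr - \<sigma> i) \<le> (\<Prod>i=1..r. real (n i) powr - d)"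
proof (cases "r = 0")
  case False
  have A: "0 \<le> (\<Sum>j=1..i. \<sigma> j - d)" if "1 \<le> i" "i \<le> r" for i
    using \<sigma>[of i] that by (simp add: sum_subtractf)
  have "(\<Sum>j=1..r. \<sigma> j - d) * ln (real (n r)) \<le> (\<Sum>j=1..r. (\<sigma> j - d) * ln (real (n j)))"
  proof (intro sum_mult_decreasing_ge A)
    fix i assume i: "1 \<le> i" "i < r"
    then have "n (Suc i) < n i" using n by (simp add: decreasing_tuples_def)
    moreover have "0 < n (Suc i)" using decreasing_tuples_pos[OF n] i by simp
    ultimately show "ln (real (n (Suc i))) \<le> ln (real (n i))" by simp
  qed
  moreover have "0 \<le> (\<Sum>j=1..r. \<sigma> j - d) * ln (real (n r))"
    using A False decreasing_tuples_pos[OF n, of r] by simp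
  ultimately have "(\<Sum>j=1..r. - \<sigma> j * ln (real (n j))) \<le> (\<Sum>j=1..r. - d * ln (real (n j)))"
    by (simp add: left_diff_distrib sum_subtractf sum_negf)
  \<comment> \<open>Positive entries keep clear of the convention
    \<open>0 powr x = 0\<close>.\<close>
  moreover have "(\<Prod>i=1..r. real (n i) powr e i) = exp (\<Sum>j=1..r. e j * ln (real (n j)))" for e
    unfolding exp_sum[OF finite_atLeastAtMost]
    using decreasing_tuples_pos[OF n] by (intro prod.cong) (auto simp: powr_def)
  ultimately show ?thesis by simp
qed simp

definition L_term :: "nat \<Rightarrow> (nat \<Rightarrow> int \<Rightarrow> complex) \<Rightarrow> (nat \<Rightarrow> complex) \<Rightarrow> (nat \<Rightarrow> nat) \<Rightarrow> complex"
  where "L_term r f s n =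
    (\<Prod>i=1..r. f i (int (n i))) / (\<Prod>i=1..r. of_nat (n i) powr s i)"

lemma multiple_L_eq: "multiple_L r f s = infsum (L_term r f s) (decreasing_tuples r)"
  by (simp add: multiple_L_def L_term_def[abs_def])

text \<open>The bound depends on \<open>f\<close> and \<open>s\<close> only through the hypotheses,
  so it is uniform over all \<open>s\<close> that admit the same \<open>d\<close>.\<close>

lemma norm_L_term_le:
  assumes char: "\<And>i. i \<in> {1..r} \<Longrightarrow> additive_character (f i)"
    and g: "\<And>i. i \<in> {1..r} \<Longrightarrow> norm (partial_product f i 1) \<le> 1"
    and s: "\<And>i. i \<in> {1..r} \<Longrightarrow> real i * d \<le> Re (\<Sum>j=1..i. s j)"
    and n: "n \<in> decreasing_tuples r"
  shows "norm (L_term r f s n) \<le> (\<Prod>i=1..r. real (n i) powr - d)"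
proof -
  have "norm (\<Prod>i=1..r. of_nat (n i) powr s i) = (\<Prod>i=1..r. real (n i) powr Re (s i))"
    unfolding prod_norm[symmetric]
    by (rule prod.cong) (simp_all add: norm_powr_real_powr)
  moreover have "(\<Prod>i=1..r. real (n i) powr - Re (s i)) = inverse (\<Prod>i=1..r. real (n i) powr Re (s i))"
    by (simp add: powr_minus prod_inversef[symmetric] o_def)
  ultimately have "norm (L_term r f s n) =
      norm (\<Prod>i=1..r. f i (int (n i))) * (\<Prod>i=1..r. real (n i) powr - Re (s i))"
    by (simp add: L_term_def divide_inverse norm_mult norm_inverse)
  also have "\<dots> \<le> 1 * (\<Prod>i=1..r. real (n i) powr - Re (s i))"
    using norm_prod_characters_le_1[OF char g n] by (intro mult_right_mono prod_nonneg) auto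
  also have "\<dots> \<le> (\<Prod>i=1..r. real (n i) powr - d)"
    using prod_powr_decreasing_le[of r d "\<lambda>i. Re (s i)" n] s n by simp
  finally show ?thesis .
qed

text \<open>Without the ordering condition the sum runs over all tuples of positive integers and
  factors into \<open>r\<close> copies of the convergent series of
  \<open>m powr - d\<close>.\<close>

lemma summable_on_prod_powr:
  assumes "d > 1"
  shows "(\<lambda>n. \<Prod>i=1..r. real (n i) powr - d) summable_on decreasing_tuples r"
proof -
  have "(\<lambda>m. norm (real m powr - d)) summable_on UNIV"
    using assms by (intro norm_summable_imp_summable_on) (simp add: summable_real_powr_iff)
  then have "Infinite_Sum.abs_summable_on (\<lambda>m. real m powr - d) {0<..}"
    by (rule summable_on_subset) auto
  then have "Infinite_Sum.abs_summable_on
      (\<lambda>n. \<Prod>i\<in>{1..r}. real (n i) powr - d) ({1..r} \<rightarrow>\<^sub>E {0<..})"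
    unfolding abs_summable_equivalent by (intro abs_summable_on_prod_PiE) auto
  then have "(\<lambda>n. \<Prod>i=1..r. real (n i) powr - d) summable_on ({1..r} \<rightarrow>\<^sub>E {0<..})"
    by (rule Infinite_Sum.abs_summable_summable)
  then show ?thesis
    by (rule summable_on_subset) (auto simp: decreasing_tuples_def)
qed

section \<open>Binomial series and telescoping\<close>

lemma norm_shifted_poch_le:
  assumes "norm z \<le> B"
  shows "norm (shifted_poch z k) \<le> pochhammer B (k + 1) / fact (k + 1)"
proof -
  have "norm (z + of_nat i) \<le> B + of_nat i" for i
    using norm_triangle_ineq[of z "of_nat i"] assms by simp
  then have "norm (pochhammer z (k + 1)) \<le> pochhammer B (k + 1)"
    unfolding pochhammer_prod prod_norm[symmetric] by (intro prod_mono) auto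
  then show ?thesis
    by (simp add: shifted_poch_def norm_divide divide_right_mono del: fact_Suc)
qed

text \<open>Up to sign, \<open>pochhammer B (k + 1) / fact (k + 1)\<close> is the binomial
  coefficient of \<open>-B\<close> over \<open>k + 1\<close>. The series is therefore the tail of
  the binomial series of \<open>(1 + x) powr - B\<close> at \<open>x = -1/2\<close>; the factor 2 in
  the proof turns \<open>(1/2) ^ (k + 1)\<close> into \<open>(1/2) ^ k\<close>.\<close>

lemma summable_pochhammer_power:
  fixes B :: real
  shows "summable (\<lambda>k. pochhammer B (k + 1) / fact (k + 1) * (1/2) ^ k)"
proof -
  have "summable (\<lambda>k. (-B gchoose k) * (-1/2) ^ k)"
    by (rule sums_summable[OF gen_binomial_real]) simp
  then have "summable (\<lambda>k. 2 * ((-B gchoose (k + 1)) * (-1/2) ^ (k + 1)))"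
    by (intro summable_mult summable_ignore_initial_segment)
  moreover have "2 * ((-B gchoose (k + 1)) * (-1/2) ^ (k + 1)) =
      pochhammer B (k + 1) / fact (k + 1) * (1/2) ^ k" for k
  proof -
    have "(-1/2::real) ^ (k + 1) = (-1) ^ (k + 1) * (1/2) ^ (k + 1)"
      by (simp flip: power_mult_distrib)
    then show ?thesis
      by (simp add: gbinomial_pochhammer del: fact_Suc flip: power_mult_distrib)
  qed
  ultimately show ?thesis by simp
qed

text \<open>The binomial expansion of \<open>(n - 1) powr - z\<close> in powers of
  \<open>1 / n\<close>, convergent since \<open>n > 1\<close>.\<close>

lemma shifted_poch_sums:
  fixes z :: complex
  assumes "n \<ge> 2"
  shows "(\<lambda>k. shifted_poch z k * (of_nat n powr - (z + 1) / of_nat n ^ k))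
           sums (of_nat (n - 1) powr - z - of_nat n powr - z)"
proof -
  let ?t = "\<lambda>k. (-z gchoose k) * of_real (real n) powr (-z - of_nat k) * of_real (-1) ^ k"
  have "?t sums of_real (real n + -1) powr -z"
    using assms by (intro gen_binomial_complex'') auto
  \<comment> \<open>The term of index 0 is \<open>n powr - z\<close> and moves to the other side;
    the term of index \<open>k + 1\<close> carries the coefficient
    \<open>shifted_poch z k\<close>.\<close>
  then have "(\<lambda>k. ?t (Suc k)) sums (of_real (real n + -1) powr -z - ?t 0)"
    by (subst sums_Suc_iff) simp
  moreover have "?t (Suc k) = shifted_poch z k * (of_nat n powr - (z + 1) / of_nat n ^ k)" for k
  proof -
    have "of_nat n powr (-z - of_nat (Suc k)) = of_nat n powr - (z + 1) / of_nat n ^ k"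
    proof -
      have "of_nat n powr (- (z + 1) - of_nat k) = of_nat n powr - (z + 1) / of_nat n powr (of_nat k :: complex)"
        by (rule powr_diff)
      moreover have "-z - of_nat (Suc k) = - (z + 1) - of_nat k"
        by simp
      ultimately show ?thesis using assms by (simp only:) (simp add: powr_nat')
    qed
    then show ?thesis
      by (simp add: shifted_poch_def gbinomial_pochhammer mult_ac del: fact_Suc flip: power_mult_distrib)
  qed
  ultimately show ?thesis using assms by (simp add: of_nat_diff)
qed

text \<open>Telescoping yields only the ordered sum, with tail tending to 0 because
  \<open>Re z > 0\<close>. Summability is assumed so that the unordered sum exists; its value must
  then be the ordered one.\<close>

lemma has_sum_telescope_powr:
  fixes c z :: complex
  assumes "Re z > 0"
    and "(\<lambda>n. c * (of_nat (n - 1) powr - z - of_nat n powr - z)) summable_on {m<..}"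
  shows "((\<lambda>n. c * (of_nat (n - 1) powr - z - of_nat n powr - z)) has_sum c * of_nat m powr - z) {m<..}"
    (is "(?g has_sum _) _")
proof -
  have bij: "bij_betw (\<lambda>j. m + Suc j) UNIV {m<..}"
    by (rule bij_betwI[of _ _ _ "\<lambda>n. n - Suc m"]) auto
  let ?a = "\<lambda>j. of_nat (m + j) powr - z"
  have "?a \<longlonglongrightarrow> 0"
  proof (rule tendsto_norm_zero_cancel)
    have "(\<lambda>n. real n powr - Re z) \<longlonglongrightarrow> 0"
      using assms by (intro tendsto_neg_powr filterlim_real_sequentially) auto
    then have "(\<lambda>j. real (j + m) powr - Re z) \<longlonglongrightarrow> 0"
      by (rule LIMSEQ_ignore_initial_segment)
    moreover have "norm (?a j) = real (j + m) powr - Re z" for j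
      by (subst norm_powr_real_powr) (auto simp: add.commute simp flip: of_nat_add)
    ultimately show "(\<lambda>j. norm (?a j)) \<longlonglongrightarrow> 0" by simp
  qed
  then have "(\<lambda>j. c * (?a j - ?a (Suc j))) sums (c * (?a 0 - 0))"
    by (intro sums_mult telescope_sums')
  then have 1: "(\<lambda>j. ?g (m + Suc j)) sums (c * of_nat m powr - z)"
    by simp
  have "(\<lambda>j. ?g (m + Suc j)) summable_on UNIV"
    using assms(2) summable_on_reindex_bij_betw[OF bij, of ?g] by blast
  then obtain S where S: "((\<lambda>j. ?g (m + Suc j)) has_sum S) UNIV"
    by (auto simp: summable_on_def)
  have "S = c * of_nat m powr - z"
    by (rule sums_unique2[OF has_sum_imp_sums[OF S] 1])
  with S show ?thesis
    using has_sum_reindex_bij_betw[OF bij, of ?g] by blast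
qed

section \<open>Splitting off the largest entry of a tuple\<close>

text \<open>The tail \<open>m\<close> comes first in the pair because the sum over the new first
  entry \<open>p\<close> will be the inner one, over a range that depends on \<open>m\<close>. The
  restriction makes the result extensional, as \<open>decreasing_tuples\<close> requires.\<close>

definition cons_tuple :: "nat \<Rightarrow> (nat \<Rightarrow> nat) \<times> nat \<Rightarrow> nat \<Rightarrow> nat" where
  "cons_tuple q = (\<lambda>(m, p). \<lambda>i\<in>{1..Suc q}. if i = 1 then p else m (i - 1))"

text \<open>As \<open>m 1\<close> is the largest entry of the tail, \<open>p > m 1\<close> already
  puts \<open>p\<close> above all of them; \<open>q \<ge> 1\<close> makes \<open>m 1\<close> an
  actual entry.\<close>

lemma bij_betw_cons_tuple:
  assumes "q \<ge> 1"
  shows "bij_betw (cons_tuple q) (SIGMA m:decreasing_tuples q. {m 1<..}) (decreasing_tuples (Suc q))"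
proof (rule bij_betwI[of _ _ _ "\<lambda>n. (\<lambda>i\<in>{1..q}. n (Suc i), n 1)"])
  show "cons_tuple q \<in> (SIGMA m:decreasing_tuples q. {m 1<..}) \<rightarrow> decreasing_tuples (Suc q)"
  proof (rule Pi_I, clarify)
    fix m p assume m: "m \<in> decreasing_tuples q" and p: "m 1 < p"
    have le: "m j \<le> m 1" if "j \<in> {1..q}" for j
      using m that by (cases "j = 1") (auto simp: decreasing_tuples_def less_imp_le)
    show "cons_tuple q (m, p) \<in> decreasing_tuples (Suc q)"
      unfolding decreasing_tuples_def
    proof (intro CollectI conjI ballI impI)
      show "cons_tuple q (m, p) \<in> {1..Suc q} \<rightarrow>\<^sub>E {0<..}"
      proof (rule PiE_I)
        fix i assume i: "i \<in> {1..Suc q}"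
        then have "0 < m (i - 1)" if "i \<noteq> 1"
          using that by (intro decreasing_tuples_pos[OF m]) auto
        with i p show "cons_tuple q (m, p) i \<in> {0<..}"
          by (simp add: cons_tuple_def)
      qed (auto simp: cons_tuple_def)
    next
      fix i j assume ij: "i \<in> {1..Suc q}" "j \<in> {1..Suc q}" "i < j"
      show "cons_tuple q (m, p) j < cons_tuple q (m, p) i"
      proof (cases "i = 1")
        case True
        have "m (j - 1) \<le> m 1" using ij by (intro le) auto
        with True ij p show ?thesis by (simp add: cons_tuple_def)
      next
        case False
        then have "i - 1 \<in> {1..q}" "j - 1 \<in> {1..q}" "i - 1 < j - 1"
          using ij by auto
        then have "m (j - 1) < m (i - 1)"
          using m unfolding decreasing_tuples_def by blast
        with False ij show ?thesis by (simp add: cons_tuple_def)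
      qed
    qed
  qed
next
  show "(\<lambda>n. (\<lambda>i\<in>{1..q}. n (Suc i), n 1)) \<in> decreasing_tuples (Suc q) \<rightarrow> (SIGMA m:decreasing_tuples q. {m 1<..})"
    using assms by (auto simp: decreasing_tuples_def PiE_iff)
next
  fix x assume "x \<in> (SIGMA m:decreasing_tuples q. {m 1<..})"
  then obtain m p where x: "x = (m, p)" and "m \<in> decreasing_tuples q" by auto
  then have "m \<in> extensional {1..q}" by (simp add: decreasing_tuples_def PiE_iff)
  then show "(\<lambda>i\<in>{1..q}. cons_tuple q x (Suc i), cons_tuple q x 1) = x"
    by (auto simp: x cons_tuple_def extensional_def fun_eq_iff)
next
  fix n assume "n \<in> decreasing_tuples (Suc q)"
  then have "n \<in> extensional {1..Suc q}" by (simp add: decreasing_tuples_def PiE_iff)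
  then show "cons_tuple q (\<lambda>i\<in>{1..q}. n (Suc i), n 1) = n"
    by (auto simp: cons_tuple_def extensional_def fun_eq_iff)
qed

lemma L_term_cons_tuple:
  "L_term (Suc q) f s (cons_tuple q (m, p)) =
     f 1 (int p) / of_nat p powr s 1 * L_term q (\<lambda>i. f (i + 1)) (\<lambda>i. s (i + 1)) m"
proof -
  have split: "(\<Prod>i=1..Suc q. F i (cons_tuple q (m, p) i)) = F 1 p * (\<Prod>i=1..q. F (Suc i) (m i))"
    for F :: "nat \<Rightarrow> nat \<Rightarrow> complex"
  proof -
    have "(\<Prod>i=1..Suc q. F i (cons_tuple q (m, p) i)) =
        F 1 (cons_tuple q (m, p) 1) * (\<Prod>i=Suc 1..Suc q. F i (cons_tuple q (m, p) i))"
      by (rule prod.atLeast_Suc_atMost) simp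
    also have "(\<Prod>i=Suc 1..Suc q. F i (cons_tuple q (m, p) i)) =
        (\<Prod>i=1..q. F (Suc i) (cons_tuple q (m, p) (Suc i)))"
      by (simp only: prod.atLeast_Suc_atMost_Suc_shift o_def)
    also have "\<dots> = (\<Prod>i=1..q. F (Suc i) (m i))"
      by (rule prod.cong) (auto simp: cons_tuple_def)
    finally show ?thesis by (simp add: cons_tuple_def)
  qed
  show ?thesis
    unfolding L_term_def using split[of "\<lambda>i x. f i (int x)"] split[of "\<lambda>i x. of_nat x powr s i"]
    by simp
qed

text \<open>Serves two purposes: with \<open>w = k\<close> it extracts the shift of the first
  argument, and with \<open>w = s 1 - 1\<close> it absorbs the telescoped power of
  \<open>n 2\<close> into the exponent \<open>s 2\<close>.\<close>

lemma L_term_add_first: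
  assumes "q \<ge> 1" "t 1 = s 1 + w" "\<And>i. i \<in> {2..q} \<Longrightarrow> t i = s i"
  shows "L_term q f t n = of_nat (n 1) powr - w * L_term q f s n"
proof -
  have "(\<Prod>i=1..q. of_nat (n i) powr t i :: complex) =
      of_nat (n 1) powr t 1 * (\<Prod>i=Suc 1..q. of_nat (n i) powr t i)"
    using assms by (intro prod.atLeast_Suc_atMost) auto
  also have "(\<Prod>i=Suc 1..q. of_nat (n i) powr t i :: complex) = (\<Prod>i=Suc 1..q. of_nat (n i) powr s i)"
    using assms(3) by (intro prod.cong) auto
  also have "of_nat (n 1) powr t 1 = (of_nat (n 1) powr w * of_nat (n 1) powr s 1 :: complex)"
    unfolding assms(2) by (simp add: powr_add)
  also have "of_nat (n 1) powr w * of_nat (n 1) powr s 1 * (\<Prod>i=Suc 1..q. of_nat (n i) powr s i) =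
      of_nat (n 1) powr w * (\<Prod>i=1..q. of_nat (n i) powr s i :: complex)"
    using assms(1) by (subst (2) prod.atLeast_Suc_atMost) (auto simp: mult.assoc)
  finally show ?thesis
    by (simp add: L_term_def powr_minus field_simps)
qed

section \<open>Uniform bounds on compact sets\<close>

text \<open>Each of the finitely many continuous functions \<open>Re (\<Sum>j=1..i. s j)\<close>
  attains its minimum on \<open>K\<close>, which strictly exceeds \<open>i\<close>. The smallest of
  these gaps gives one \<open>d\<close> for all \<open>i\<close>.\<close>

lemma compact_subset_U_bounds:
  assumes K: "compactin (cspace r) K" "K \<subseteq> U r" and r: "r \<ge> 1"
  obtains d B where "d > 1" "B \<ge> 0"
    "\<forall>s\<in>K. \<forall>i\<in>{1..r}. real i * d \<le> Re (\<Sum>j=1..i. s j)"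
    "\<forall>s\<in>K. norm (s 1 - 1) \<le> B"
proof (cases "K = {}")
  case True
  \<comment> \<open>On the empty set no minimum is attained, but any admissible constants will
    do.\<close>
  with that[of 2 0] show ?thesis by simp
next
  case False
  have coord: "continuous_map (cspace r) euclidean (\<lambda>s. s j)" if "j \<in> {1..r}" for j
    unfolding cspace_def using that
    by (rule continuous_map_product_coordinates[of j "{1..r}" "\<lambda>_. euclidean"])
  have comp: "compact ((\<lambda>s. g (h s)) ` K)"
    if "continuous_map (cspace r) euclidean h" "continuous_on UNIV g"
    for h :: "(nat \<Rightarrow> complex) \<Rightarrow> complex" and g :: "complex \<Rightarrow> real"
  proof -
    have "compact (h ` K)"
      using image_compactin[OF K(1) that(1)] by simp
    then have "compact (g ` h ` K)"
      by (rule compact_continuous_image[OF continuous_on_subset[OF that(2) subset_UNIV]])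
    then show ?thesis by (simp add: image_image)
  qed
  have "\<exists>e>0. \<forall>s\<in>K. real i + e \<le> Re (\<Sum>j=1..i. s j)" if i: "i \<in> {1..r}" for i
  proof -
    have "continuous_map (cspace r) euclidean (\<lambda>s. \<Sum>j=1..i. s j)"
      using i by (intro continuous_map_sum coord) auto
    then have "compact ((\<lambda>s. Re (\<Sum>j=1..i. s j)) ` K)"
      by (rule comp) (intro continuous_intros)
    then obtain s0 where "s0 \<in> K" "\<And>s. s \<in> K \<Longrightarrow> Re (\<Sum>j=1..i. s0 j) \<le> Re (\<Sum>j=1..i. s j)"
      using compact_attains_inf[of "(\<lambda>s. Re (\<Sum>j=1..i. s j)) ` K"] False by blast
    moreover have "real i < Re (\<Sum>j=1..i. s0 j)"
      using \<open>s0 \<in> K\<close> K(2) i by (auto simp: U_def)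
    ultimately show ?thesis
      by (intro exI[of _ "Re (\<Sum>j=1..i. s0 j) - real i"]) auto
  qed
  then obtain e where e: "\<And>i. i \<in> {1..r} \<Longrightarrow> e i > 0"
    "\<And>i s. i \<in> {1..r} \<Longrightarrow> s \<in> K \<Longrightarrow> real i + e i \<le> Re (\<Sum>j=1..i. s j)"
    by metis
  define \<epsilon> where "\<epsilon> = Min (e ` {1..r})"
  have \<epsilon>: "\<epsilon> > 0" "\<And>i. i \<in> {1..r} \<Longrightarrow> \<epsilon> \<le> e i"
    using r e(1) by (auto simp: \<epsilon>_def)
  have "compact ((\<lambda>s. norm (s 1 - 1)) ` K)"
    using r by (intro comp coord continuous_intros) auto
  then obtain B where B: "\<And>s. s \<in> K \<Longrightarrow> norm (s 1 - 1) \<le> B"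
    using compact_attains_sup[of "(\<lambda>s. norm (s 1 - 1)) ` K"] False by blast
  show ?thesis
  \<comment> \<open>Dividing by \<open>r\<close> compensates the multiplication by \<open>i\<close>:
    \<open>i * (\<epsilon> / r) \<le> \<epsilon>\<close> for \<open>i \<le> r\<close>.\<close>
  proof (rule that[of "1 + \<epsilon> / real r" B])
    show "1 + \<epsilon> / real r > 1" using \<epsilon> r by simp
    show "B \<ge> 0" using B False norm_ge_zero order_trans by blast
    show "\<forall>s\<in>K. norm (s 1 - 1) \<le> B" using B by blast
    show "\<forall>s\<in>K. \<forall>i\<in>{1..r}. real i * (1 + \<epsilon> / real r) \<le> Re (\<Sum>j=1..i. s j)"
    proof (intro ballI)
      fix s i assume s: "s \<in> K" and i: "i \<in> {1..r}"
      have "real i * \<epsilon> \<le> \<epsilon> * real r" using i \<epsilon> by (simp add: mult.commute)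
      then have "real i * (1 + \<epsilon> / real r) \<le> real i + \<epsilon>"
        using r by (simp add: field_simps)
      also have "\<dots> \<le> real i + e i" using \<epsilon> i by simp
      also have "\<dots> \<le> Re (\<Sum>j=1..i. s j)" using e i s by simp
      finally show "real i * (1 + \<epsilon> / real r) \<le> Re (\<Sum>j=1..i. s j)" .
    qed
  qed
qed

lemma L_term_shift:
  assumes "r \<ge> 1" "n \<in> decreasing_tuples r"
  shows "L_term r f (s(1 := s 1 + of_nat k)) n = L_term r f s n / of_nat (n 1) ^ k"
proof -
  have "L_term r f (s(1 := s 1 + of_nat k)) n = of_nat (n 1) powr - of_nat k * L_term r f s n"
    using assms by (intro L_term_add_first) auto
  moreover have "n 1 \<noteq> 0" using decreasing_tuples_pos[OF assms(2), of 1] assms(1) by simp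
  ultimately show ?thesis by (simp add: powr_minus powr_nat' field_simps)
qed

text \<open>The majorant is a function of \<open>k\<close> times a function of \<open>n\<close>, and
  involves \<open>s\<close> only through \<open>d\<close> and \<open>B\<close>: the first makes it
  summable over pairs, the second makes it uniform on compact sets.\<close>

lemma norm_shifted_poch_L_term_le:
  assumes r: "r \<ge> 2"
    and char: "\<And>i. i \<in> {1..r} \<Longrightarrow> additive_character (f i)"
    and g: "\<And>i. i \<in> {1..r} \<Longrightarrow> norm (partial_product f i 1) \<le> 1"
    and s: "\<And>i. i \<in> {1..r} \<Longrightarrow> real i * d \<le> Re (\<Sum>j=1..i. s j)"
    and B: "norm (s 1 - 1) \<le> B"
    and n: "n \<in> decreasing_tuples r"
  shows "norm (shifted_poch (s 1 - 1) k * L_term r f (s(1 := s 1 + of_nat k)) n)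
     \<le> pochhammer B (k + 1) / fact (k + 1) * (1/2) ^ k * (\<Prod>i=1..r. real (n i) powr - d)"
proof -
  \<comment> \<open>Here \<open>r \<ge> 2\<close> enters: it forces \<open>n 1 \<ge> 2\<close>,
    hence geometric decay in \<open>k\<close>.\<close>
  have "n 2 > 0" "n 2 < n 1"
    using decreasing_tuples_pos[OF n, of 2] n r by (auto simp: decreasing_tuples_def)
  then have "1 / real (n 1) \<le> 1 / 2" by (intro divide_left_mono) auto
  then have "(1 / real (n 1)) ^ k \<le> (1/2) ^ k" by (intro power_mono) auto
  moreover have "norm (shifted_poch (s 1 - 1) k * L_term r f (s(1 := s 1 + of_nat k)) n)
      = norm (shifted_poch (s 1 - 1) k) * (1 / real (n 1)) ^ k * norm (L_term r f s n)"
    using L_term_shift[of r n f s k] r n by (simp add: norm_mult norm_divide norm_power power_divide)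
  ultimately show ?thesis
    using norm_shifted_poch_le[OF B, of k] norm_L_term_le[OF char g s n]
      order_trans[OF norm_ge_zero norm_shifted_poch_le[OF B, of k]]
    by (simp only:) (intro mult_mono mult_nonneg_nonneg norm_ge_zero; simp del: fact_Suc)
qed

section \<open>Double summation over \<open>k\<close> and decreasing tuples\<close>

theorem theorem2p5:
  fixes r :: nat and f :: "nat \<Rightarrow> int \<Rightarrow> complex"
  assumes "r \<ge> 2"
    and "\<And>i. i \<in> {1..r} \<Longrightarrow> additive_character (f i)"
    and "\<And>i. i \<in> {1..r} \<Longrightarrow> norm (partial_product f i 1) \<le> 1"
    and "f 1 1 = 1"
  shows "(\<forall>s\<in>U r.
            (\<lambda>k. shifted_poch (s 1 - 1) k * multiple_L r f (s(1 := s 1 + of_nat k)))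
              sums multiple_L (r - 1) (\<lambda>i. f (i + 1))
                     (\<lambda>i. if i = 1 then s 1 + s 2 - 1 else s (i + 1)))
       \<and> (\<forall>K. compactin (cspace r) K \<and> K \<subseteq> U r \<longrightarrow>
            normally_convergent_on K
              (\<lambda>k s. shifted_poch (s 1 - 1) k * multiple_L r f (s(1 := s 1 + of_nat k))))"
proof (intro conjI ballI allI impI)
  let ?D = "decreasing_tuples r"
  let ?M = "\<lambda>d n. \<Prod>i=1..r. real (n i) powr - d"
  let ?c = "\<lambda>B k. pochhammer B (k + 1) / fact (k + 1) * (1/2) ^ k"
  let ?F = "\<lambda>s k n. shifted_poch (s 1 - 1) k * L_term r f (s(1 := s 1 + of_nat k)) n"
  have r1: "r \<ge> 1" using assms(1) by simp
  have bound: "norm (?F s k n) \<le> ?c B k * ?M d n"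
    if "\<And>i. i \<in> {1..r} \<Longrightarrow> real i * d \<le> Re (\<Sum>j=1..i. s j)" "norm (s 1 - 1) \<le> B" "n \<in> ?D"
    for s k n B d
    using norm_shifted_poch_L_term_le[OF assms(1,2,3) that] .
  have c_nonneg: "?c B k \<ge> 0" if "B \<ge> 0" for B :: real and k
    unfolding pochhammer_prod using that
    by (intro mult_nonneg_nonneg divide_nonneg_nonneg prod_nonneg) auto
  have F_infsum: "infsum (?F s k) ?D = shifted_poch (s 1 - 1) k * multiple_L r f (s(1 := s 1 + of_nat k))"
    for s k by (simp add: infsum_cmult_right' multiple_L_eq)

  {
    fix s assume s: "s \<in> U r"
    \<comment> \<open>A singleton is compact, so the bounds for compact sets also serve at a single
      point.\<close>
    have "compactin (cspace r) {s}"
      using s by (simp add: cspace_def U_def)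
    then obtain d B where d: "d > 1" and B0: "B \<ge> 0"
      and "\<forall>s\<in>{s}. \<forall>i\<in>{1..r}. real i * d \<le> Re (\<Sum>j=1..i. s j)"
        "\<forall>s\<in>{s}. norm (s 1 - 1) \<le> B"
      by (rule compact_subset_U_bounds) (use s r1 in auto)
    then have ds: "\<And>i. i \<in> {1..r} \<Longrightarrow> real i * d \<le> Re (\<Sum>j=1..i. s j)"
      and sB: "norm (s 1 - 1) \<le> B" by blast+
    have "(\<lambda>(k, n). ?c B k * ?M d n) summable_on UNIV \<times> ?D"
    proof (rule summable_on_SigmaI)
      show "((\<lambda>n. case (k, n) of (k, n) \<Rightarrow> ?c B k * ?M d n) has_sum ?c B k * infsum (?M d) ?D) ?D" for k
        unfolding prod.case using summable_on_prod_powr[OF d] by (intro has_sum_cmult_right has_sum_infsum)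
      have "(\<lambda>k. ?c B k) summable_on UNIV"
        using summable_pochhammer_power[of B] c_nonneg[OF B0]
        by (subst summable_on_UNIV_nonneg_real_iff) auto
      then show "(\<lambda>k. ?c B k * infsum (?M d) ?D) summable_on UNIV"
        by (rule summable_on_cmult_left)
      show "0 \<le> (case (k, n) of (k, n) \<Rightarrow> ?c B k * ?M d n)" for k n
        unfolding prod.case by (intro mult_nonneg_nonneg[OF c_nonneg[OF B0]] prod_nonneg) auto
    qed
    then have "(\<lambda>(k, n). norm (?F s k n)) summable_on UNIV \<times> ?D"
      using Infinite_Sum.abs_summable_on_comparison_test'[where f = "\<lambda>(k, n). ?F s k n"
          and g = "\<lambda>(k, n). ?c B k * ?M d n" and A = "UNIV \<times> ?D"]
        bound[OF ds sB] by (simp add: case_prod_unfold mem_Times_iff)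
    then have summ: "(\<lambda>(k, n). ?F s k n) summable_on UNIV \<times> ?D"
      using Infinite_Sum.abs_summable_summable[of "\<lambda>(k, n). ?F s k n"]
      by (simp add: case_prod_unfold)
    \<comment> \<open>\<open>S\<close> is the value of the absolutely convergent double series.
      Summing over \<open>n\<close> first gives the series of the theorem, summing over
      \<open>k\<close> first gives the L-value of depth \<open>r - 1\<close>.\<close>
    obtain S where S: "((\<lambda>(k, n). ?F s k n) has_sum S) (UNIV \<times> ?D)"
      using summ unfolding summable_on_def by blast
    have S': "((\<lambda>(n, k). ?F s k n) has_sum S) (?D \<times> UNIV)"
      using S has_sum_swap[where f = "\<lambda>(k, n). ?F s k n" and A = UNIV and B = ?D] by (simp only: prod.case)
    have sum_n: "?F s k summable_on ?D" for k
      using summable_on_SigmaD1[OF summ, of k] by simp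
    have sum_k: "(\<lambda>k. ?F s k n) summable_on UNIV" if "n \<in> ?D" for n
      using summable_on_SigmaD1[OF has_sum_imp_summable[OF S'] that] .
    have "((\<lambda>k. infsum (?F s k) ?D) has_sum S) UNIV"
      by (rule has_sum_SigmaD[OF S]) (simp only: prod.case has_sum_infsum[OF sum_n])
    then have sums_S: "(\<lambda>k. shifted_poch (s 1 - 1) k * multiple_L r f (s(1 := s 1 + of_nat k))) sums S"
      unfolding F_infsum by (rule has_sum_imp_sums)
    define q where "q = r - 1"
    have q: "r = Suc q" "q \<ge> 1" using assms(1) by (auto simp: q_def)
    define z where "z = s 1 - 1"
    have z: "Re z > 0" using ds[of 1] d r1 by (simp add: z_def)
    \<comment> \<open>\<open>R m\<close> is the part of the term that depends on neither
      \<open>k\<close> nor \<open>p\<close>; \<open>G m p\<close> will be the sum over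
      \<open>k\<close> at the tuple with first entry \<open>p\<close> and tail
      \<open>m\<close>.\<close>
    define R where "R = L_term q (\<lambda>i. f (i + 1)) (\<lambda>i. s (i + 1))"
    define G where "G m p = R m * (of_nat (p - 1) powr - z - of_nat p powr - z)" for m p
    have inner: "((\<lambda>k. ?F s k (cons_tuple q (m, p))) has_sum G m p) UNIV"
      if m: "m \<in> decreasing_tuples q" and p: "p \<in> {m 1<..}" for m p
    proof -
      have n: "cons_tuple q (m, p) \<in> ?D"
        using bij_betw_apply[OF bij_betw_cons_tuple[OF q(2)], of "(m, p)"] m p q(1) by simp
      have p2: "p \<ge> 2" using decreasing_tuples_pos[OF m, of 1] p q(2) by simp
      have f1: "f 1 (int p) = 1"
        using additive_character_of_nat[OF assms(2), of 1 p] r1 assms(4) by simp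
      have p1: "cons_tuple q (m, p) 1 = p" by (simp add: cons_tuple_def)
      have z1: "s 1 = z + 1" by (simp add: z_def)
      have eq: "?F s k (cons_tuple q (m, p)) =
          R m * (shifted_poch z k * (of_nat p powr - (z + 1) / of_nat p ^ k))" for k
        unfolding L_term_shift[OF r1 n] p1 unfolding q(1) L_term_cons_tuple f1 R_def[symmetric] z1
          powr_minus by (simp add: divide_inverse mult_ac)
      have G: "(\<lambda>k. ?F s k (cons_tuple q (m, p))) sums G m p"
        unfolding eq G_def by (intro sums_mult shifted_poch_sums p2)
      \<comment> \<open>The unordered sum over \<open>k\<close> exists by absolute convergence; the
        binomial series identifies its value.\<close>
      have H: "((\<lambda>k. ?F s k (cons_tuple q (m, p))) has_sum infsum (\<lambda>k. ?F s k (cons_tuple q (m, p))) UNIV) UNIV"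
        by (rule has_sum_infsum[OF sum_k[OF n]])
      show ?thesis
        using H unfolding sums_unique2[OF has_sum_imp_sums[OF H] G] .
    qed
    have "((\<lambda>n. infsum (\<lambda>k. ?F s k n) UNIV) has_sum S) ?D"
      by (rule has_sum_SigmaD[OF S']) (simp only: prod.case has_sum_infsum[OF sum_k])
    then have "((\<lambda>x. infsum (\<lambda>k. ?F s k (cons_tuple q x)) UNIV) has_sum S)
        (SIGMA m:decreasing_tuples q. {m 1<..})"
      using has_sum_reindex_bij_betw[OF bij_betw_cons_tuple[OF q(2)],
          where f = "\<lambda>n. infsum (\<lambda>k. ?F s k n) UNIV"] by (simp only: q(1))
    moreover have "infsum (\<lambda>k. ?F s k (cons_tuple q x)) UNIV = (case x of (m, p) \<Rightarrow> G m p)"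
      if "x \<in> (SIGMA m:decreasing_tuples q. {m 1<..})" for x
      using that infsumI[OF inner] by (cases x) (simp only: prod.case mem_Sigma_iff)
    ultimately have G: "((\<lambda>(m, p). G m p) has_sum S) (SIGMA m:decreasing_tuples q. {m 1<..})"
      by (subst (asm) has_sum_cong)
    \<comment> \<open>The sum over \<open>p > m 1\<close> telescopes; its summability is inherited
      from the double family.\<close>
    have "((\<lambda>m. R m * of_nat (m 1) powr - z) has_sum S) (decreasing_tuples q)"
    proof (rule has_sum_SigmaD[OF G])
      fix m assume "m \<in> decreasing_tuples q"
      then have "G m summable_on {m 1<..}"
        using summable_on_SigmaD1[OF has_sum_imp_summable[OF G]] by simp
      then show "((\<lambda>p. case (m, p) of (m, p) \<Rightarrow> G m p) has_sum R m * of_nat (m 1) powr - z) {m 1<..}"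
        unfolding prod.case G_def by (rule has_sum_telescope_powr[OF z])
    qed
    \<comment> \<open>The entry \<open>m 1\<close> carries the exponent \<open>s 2\<close>, and
      \<open>z = s 1 - 1\<close> raises it to \<open>s 1 + s 2 - 1\<close>.\<close>
    moreover have "L_term q (\<lambda>i. f (i + 1)) (\<lambda>i. if i = 1 then s 1 + s 2 - 1 else s (i + 1))
        = (\<lambda>m. R m * of_nat (m 1) powr - z)"
      unfolding R_def
      by (rule ext, subst L_term_add_first[where s = "\<lambda>i. s (i + 1)" and w = z])
         (use q(2) in \<open>auto simp: z_def numeral_2_eq_2\<close>)
    ultimately have "multiple_L (r - 1) (\<lambda>i. f (i + 1))
        (\<lambda>i. if i = 1 then s 1 + s 2 - 1 else s (i + 1)) = S"
      unfolding multiple_L_eq q_def[symmetric] by (simp only: infsumI)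
    with sums_S show "(\<lambda>k. shifted_poch (s 1 - 1) k * multiple_L r f (s(1 := s 1 + of_nat k)))
        sums multiple_L (r - 1) (\<lambda>i. f (i + 1)) (\<lambda>i. if i = 1 then s 1 + s 2 - 1 else s (i + 1))"
      by simp
  next

    \<comment> \<open>Normal convergence on compact sets\<close>
    fix K assume "compactin (cspace r) K \<and> K \<subseteq> U r"
    then have "compactin (cspace r) K" "K \<subseteq> U r" by auto
    then obtain d B where d: "d > 1" and B0: "B \<ge> 0"
      and ds: "\<forall>s\<in>K. \<forall>i\<in>{1..r}. real i * d \<le> Re (\<Sum>j=1..i. s j)"
      and sB: "\<forall>s\<in>K. norm (s 1 - 1) \<le> B"
      using r1 by (rule compact_subset_U_bounds)
    \<comment> \<open>This constant depends on neither \<open>s\<close> nor \<open>k\<close>, so it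
      bounds the suprema over \<open>K\<close> once multiplied by the coefficient bound.\<close>
    let ?I = "infsum (?M d) ?D"
    have I: "?I \<ge> 0" by (intro infsum_nonneg prod_nonneg) auto
    have le: "norm (shifted_poch (s 1 - 1) k * multiple_L r f (s(1 := s 1 + of_nat k))) \<le> ?c B k * ?I"
      if "s \<in> K" for s k
    proof -
      have M: "((\<lambda>n. ?c B k * ?M d n) has_sum ?c B k * ?I) ?D"
        using summable_on_prod_powr[OF d] by (intro has_sum_cmult_right has_sum_infsum)
      have *: "norm (?F s k n) \<le> ?c B k * ?M d n" if "n \<in> ?D" for n
        using ds sB \<open>s \<in> K\<close> by (intro bound that) auto
      have "?F s k summable_on ?D"
        by (rule Infinite_Sum.abs_summable_summable
            [OF Infinite_Sum.abs_summable_on_comparison_test'[OF has_sum_imp_summable[OF M] *]])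
      then show ?thesis
        unfolding F_infsum[symmetric] by (rule norm_infsum_le[OF has_sum_infsum M *])
    qed
    have "(\<Sum>k. SUP s\<in>K. ennreal (norm (shifted_poch (s 1 - 1) k * multiple_L r f (s(1 := s 1 + of_nat k)))))
        \<le> (\<Sum>k. ennreal (?c B k * ?I))"
      using le by (intro suminf_le SUP_least ennreal_leI) auto
    also have "\<dots> < \<infinity>"
      unfolding infinity_ennreal_def less_top[symmetric]
      by (rule ennreal_suminf_neq_top[OF summable_mult2[OF summable_pochhammer_power]
            mult_nonneg_nonneg[OF c_nonneg[OF B0] I]])
    finally show "normally_convergent_on K
        (\<lambda>k s. shifted_poch (s 1 - 1) k * multiple_L r f (s(1 := s 1 + of_nat k)))"
      by (simp add: normally_convergent_on_def)
  }
qed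

end
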